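(* Let $\mathcal{C}$ be a symmetric collection of sub-intervals $[p,q]$ (with $1\le p<q\le n$) of the integer interval $[1,n]$. Let $G_{\mathcal{C}}$ be the group with generators $s_I$, $I\in\mathcal{C}$, and as relations all relations of types (j1)–(j3) of $J_n$ that involve only generators $s_I$ with $I \in \mathcal{C}$. Then the natural homomorphism $G_{\mathcal{C}} \to J_n$, $s_I\mapsto s_I$, is injective; i.e. the set of generators $\{s_I \mid I\in\mathcal{C}\}$ is complete.
   Context: For $n \ge 2$, the cactus group $J_n$ is the group with generators $s_{p,q}$ ($=s_{[p,q]}$) for $1 \le p < q \le n$ and relations: (j1) $s_{p,q}^2 = 1$; (j2) $s_{p,q}s_{m,r} = s_{m,r}s_{p,q}$ whenever $[p,q]\cap[m,r]=\emptyset$; (j3) $s_{p,q}s_{m,r} = s_{p+q-r,\,p+q-m}\,s_{p,q}$ whenever $[m,r]\subset[p,q]$. Given a group presentation $\langle S\mid R\rangle$ and a subset $I\subseteq S$, one forms $\langle I \mid R_I\rangle$ where $R_I$ consists of the relations of $R$ involving only generators in $I$; $I$ is called complete if the natural map $\langle I\mid R_I\rangle \to \langle S\mid R\rangle$ is injective. A collection $\mathcal{C}$ of sub-intervals of $[1,n]$ is called symmetric if whenever $[m,r]\subset[p,q]$ are both in $\mathcal{C}$, the interval $[p+q-r,\,p+q-m]$ is also in $\mathcal{C}$. *)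

theory Defs
  imports "HOL-Algebra.Group"
begin

text \<open>
  Group presentations. A word over the generators \<open>S\<close> is a list of letters \<open>(x, b)\<close>, where
  \<open>(x, True)\<close> stands for the generator \<open>x\<close> and \<open>(x, False)\<close> for its formal inverse. A relation
  \<open>u = v\<close> is a pair of words \<open>(u, v)\<close>.
\<close>

type_synonym 'a word = "('a \<times> bool) list"

definition words :: "'a set \<Rightarrow> 'a word set" where
  "words S = lists (S \<times> UNIV)"

inductive_set pres_cong :: "'a set \<Rightarrow> ('a word \<times> 'a word) set \<Rightarrow> ('a word \<times> 'a word) set"
  for S :: "'a set" and R :: "('a word \<times> 'a word) set" where
  refl: "w \<in> words S \<Longrightarrow> (w, w) \<in> pres_cong S R"
| sym: "(v, w) \<in> pres_cong S R \<Longrightarrow> (w, v) \<in> pres_cong S R"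
| trans: "(u, v) \<in> pres_cong S R \<Longrightarrow> (v, w) \<in> pres_cong S R \<Longrightarrow> (u, w) \<in> pres_cong S R"
| cancel: "u \<in> words S \<Longrightarrow> v \<in> words S \<Longrightarrow> x \<in> S \<Longrightarrow>
    (u @ [(x, b), (x, \<not> b)] @ v, u @ v) \<in> pres_cong S R"
| rel: "u \<in> words S \<Longrightarrow> v \<in> words S \<Longrightarrow> (l, r) \<in> R \<Longrightarrow> l \<in> words S \<Longrightarrow> r \<in> words S \<Longrightarrow>
    (u @ l @ v, u @ r @ v) \<in> pres_cong S R"

definition presented_group :: "'a set \<Rightarrow> ('a word \<times> 'a word) set \<Rightarrow> 'a word set monoid" where
  "presented_group S R =
    \<lparr>carrier = words S // pres_cong S R,
     mult = (\<lambda>A B. \<Union>a\<in>A. \<Union>b\<in>B. pres_cong S R `` {a @ b}),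
     one = pres_cong S R `` {[]}\<rparr>"

definition pres_gen :: "'a set \<Rightarrow> ('a word \<times> 'a word) set \<Rightarrow> 'a \<Rightarrow> 'a word set" where
  "pres_gen S R x = pres_cong S R `` {[(x, True)]}"

definition rels_restrict :: "('a word \<times> 'a word) set \<Rightarrow> 'a set \<Rightarrow> ('a word \<times> 'a word) set" where
  "rels_restrict R I = {(u, v) \<in> R. u \<in> words I \<and> v \<in> words I}"

text \<open>
  The natural map from \<open>presented_group I (rels_restrict R I)\<close> to \<open>presented_group S R\<close>, for
  \<open>I \<subseteq> S\<close>: the class of a word over \<open>I\<close> goes to the class of the same word over \<open>S\<close>.
\<close>

definition pres_natural :: "'a set \<Rightarrow> ('a word \<times> 'a word) set \<Rightarrow> 'a word set \<Rightarrow> 'a word set" where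
  "pres_natural S R A = (\<Union>w\<in>A. pres_cong S R `` {w})"

definition complete_gens :: "'a set \<Rightarrow> ('a word \<times> 'a word) set \<Rightarrow> 'a set \<Rightarrow> bool" where
  "complete_gens S R I \<longleftrightarrow>
    I \<subseteq> S \<and> inj_on (pres_natural S R) (carrier (presented_group I (rels_restrict R I)))"

text \<open>The integer interval \<open>[p, q]\<close> with \<open>p < q\<close> is encoded as the pair \<open>(p, q)\<close>. Below, \<open>p + q - r\<close>
  is never truncated, since \<open>r \<le> q\<close>; inclusion of intervals may be non-strict because the case of
  equality only adds trivial relations and conditions.\<close>

definition cactus_gens :: "nat \<Rightarrow> (nat \<times> nat) set" where
  "cactus_gens n = {(p, q). 1 \<le> p \<and> p < q \<and> q \<le> n}"

definition cactus_rels :: "nat \<Rightarrow> ((nat \<times> nat) word \<times> (nat \<times> nat) word) set" where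
  "cactus_rels n =
    {([((p, q), True), ((p, q), True)], []) | p q. (p, q) \<in> cactus_gens n} \<union>
    {([((p, q), True), ((m, r), True)], [((m, r), True), ((p, q), True)]) | p q m r.
      (p, q) \<in> cactus_gens n \<and> (m, r) \<in> cactus_gens n \<and> {p..q} \<inter> {m..r} = {}} \<union>
    {([((p, q), True), ((m, r), True)], [((p + q - r, p + q - m), True), ((p, q), True)]) | p q m r.
      (p, q) \<in> cactus_gens n \<and> (m, r) \<in> cactus_gens n \<and> {m..r} \<subseteq> {p..q}}"

definition cactus_group :: "nat \<Rightarrow> (nat \<times> nat) word set monoid" where
  "cactus_group n = presented_group (cactus_gens n) (cactus_rels n)"

definition symmetric_collection :: "(nat \<times> nat) set \<Rightarrow> bool" where
  "symmetric_collection C \<longleftrightarrow>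
    (\<forall>p q m r. (p, q) \<in> C \<longrightarrow> (m, r) \<in> C \<longrightarrow> {m..r} \<subseteq> {p..q} \<longrightarrow> (p + q - r, p + q - m) \<in> C)"

definition cactus_restricted_group :: "nat \<Rightarrow> (nat \<times> nat) set \<Rightarrow> (nat \<times> nat) word set monoid" where
  "cactus_restricted_group n C = presented_group C (rels_restrict (cactus_rels n) C)"

lemma words_append [simp]: "u @ v \<in> words S \<longleftrightarrow> u \<in> words S \<and> v \<in> words S"
  by (auto simp: words_def)

lemma words_Nil [simp]: "[] \<in> words S"
  by (simp add: words_def)

lemma words_Cons [simp]: "(x, b) # w \<in> words S \<longleftrightarrow> x \<in> S \<and> w \<in> words S"
  by (auto simp: words_def)

lemma pres_cong_words:
  assumes "(v, w) \<in> pres_cong S R"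
  shows "v \<in> words S \<and> w \<in> words S"
  using assms by induction auto

lemma equiv_pres_cong: "equiv (words S) (pres_cong S R)"
proof (rule equivI)
  show "pres_cong S R \<subseteq> words S \<times> words S"
    using pres_cong_words by fast
  show "refl_on (words S) (pres_cong S R)"
    by (rule refl_onI) (rule pres_cong.refl)
  show "sym (pres_cong S R)"
    by (rule symI) (rule pres_cong.sym)
  show "trans (pres_cong S R)"
    by (rule transI) (rule pres_cong.trans)
qed

lemma pres_cong_context:
  assumes "(v, w) \<in> pres_cong S R" "a \<in> words S" "b \<in> words S"
  shows "(a @ v @ b, a @ w @ b) \<in> pres_cong S R"
  using assms
proof induction
  case (cancel u v x c)
  then show ?case using pres_cong.cancel[of "a @ u" S "v @ b" x c R] by simp
next
  case (rel u v l r)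
  then show ?case using pres_cong.rel[of "a @ u" S "v @ b" l r R] by simp
next
  case (refl w)
  then show ?case by (simp add: pres_cong.refl)
next
  case (sym v w)
  then show ?case by (simp add: pres_cong.sym)
next
  case (trans u v w)
  then show ?case by (meson pres_cong.trans)
qed

lemma pres_cong_append:
  assumes "(a, a') \<in> pres_cong S R" "(b, b') \<in> pres_cong S R"
  shows "(a @ b, a' @ b') \<in> pres_cong S R"
proof -
  have "(a @ b, a' @ b) \<in> pres_cong S R"
    using pres_cong_context[OF assms(1), of "[]" b] pres_cong_words[OF assms(2)] by simp
  moreover have "(a' @ b, a' @ b') \<in> pres_cong S R"
    using pres_cong_context[OF assms(2), of a' "[]"] pres_cong_words[OF assms(1)] by simp
  ultimately show ?thesis by (rule pres_cong.trans)
qed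

lemma pres_cong_class_eq:
  assumes "(v, w) \<in> pres_cong S R"
  shows "pres_cong S R `` {v} = pres_cong S R `` {w}"
  using equiv_class_eq[OF equiv_pres_cong assms] .

lemma presented_group_mult:
  assumes "a \<in> words S" "b \<in> words S"
  shows "pres_cong S R `` {a} \<otimes>\<^bsub>presented_group S R\<^esub> pres_cong S R `` {b}
    = pres_cong S R `` {a @ b}"
proof -
  have "congruent2 (pres_cong S R) (pres_cong S R) (\<lambda>a b. pres_cong S R `` {a @ b})"
    by (rule congruent2I') (rule pres_cong_class_eq, rule pres_cong_append)
  from UN_equiv_class2[OF equiv_pres_cong equiv_pres_cong this assms]
  show ?thesis by (simp add: presented_group_def)
qed

lemma presented_group_carrierE:
  assumes "A \<in> carrier (presented_group S R)"
  obtains w where "w \<in> words S" "A = pres_cong S R `` {w}"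
  using assms by (auto simp: presented_group_def elim: quotientE)

lemma presented_group_carrierI:
  "w \<in> words S \<Longrightarrow> pres_cong S R `` {w} \<in> carrier (presented_group S R)"
  by (simp add: presented_group_def quotientI)

lemma pres_cong_inverse:
  assumes "w \<in> words S"
  shows "(rev (map (\<lambda>(x, b). (x, \<not> b)) w) @ w, []) \<in> pres_cong S R
    \<and> rev (map (\<lambda>(x, b). (x, \<not> b)) w) \<in> words S"
  using assms
proof (induction w)
  case Nil
  then show ?case by (simp add: pres_cong.refl)
next
  case (Cons y w)
  obtain x b where y: "y = (x, b)" by (cases y)
  let ?i = "rev (map (\<lambda>(x, b). (x, \<not> b)) w)"
  have IH: "(?i @ w, []) \<in> pres_cong S R" "?i \<in> words S"
    and x: "x \<in> S" "w \<in> words S" using Cons y by auto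
  have "(?i @ [(x, \<not> b), (x, \<not> \<not> b)] @ w, ?i @ w) \<in> pres_cong S R"
    by (rule pres_cong.cancel) (use IH x in auto)
  then have "(?i @ [(x, \<not> b), (x, \<not> \<not> b)] @ w, []) \<in> pres_cong S R"
    using IH(1) by (rule pres_cong.trans)
  then show ?case using IH x y by simp
qed

lemma group_presented_group: "group (presented_group S R)"
proof (rule groupI)
  have one: "\<one>\<^bsub>presented_group S R\<^esub> = pres_cong S R `` {[]}"
    by (simp add: presented_group_def)
  show "\<one>\<^bsub>presented_group S R\<^esub> \<in> carrier (presented_group S R)"
    by (simp add: one presented_group_carrierI)
  fix A assume A: "A \<in> carrier (presented_group S R)"
  then obtain a where a: "a \<in> words S" "A = pres_cong S R `` {a}"
    by (rule presented_group_carrierE)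
  show "\<one>\<^bsub>presented_group S R\<^esub> \<otimes>\<^bsub>presented_group S R\<^esub> A = A"
    using a by (simp add: one presented_group_mult)
  show "\<exists>B\<in>carrier (presented_group S R).
      B \<otimes>\<^bsub>presented_group S R\<^esub> A = \<one>\<^bsub>presented_group S R\<^esub>"
  proof (rule bexI)
    let ?i = "rev (map (\<lambda>(x, b). (x, \<not> b)) a)"
    have i: "(?i @ a, []) \<in> pres_cong S R" "?i \<in> words S"
      using pres_cong_inverse[OF a(1), of R] by auto
    show "pres_cong S R `` {?i} \<otimes>\<^bsub>presented_group S R\<^esub> A = \<one>\<^bsub>presented_group S R\<^esub>"
      unfolding a(2) one presented_group_mult[OF i(2) a(1)] by (rule pres_cong_class_eq[OF i(1)])
    show "pres_cong S R `` {?i} \<in> carrier (presented_group S R)"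
      by (rule presented_group_carrierI[OF i(2)])
  qed
  fix B assume "B \<in> carrier (presented_group S R)"
  then obtain b where b: "b \<in> words S" "B = pres_cong S R `` {b}"
    by (rule presented_group_carrierE)
  show "A \<otimes>\<^bsub>presented_group S R\<^esub> B \<in> carrier (presented_group S R)"
    using a b by (simp add: presented_group_mult presented_group_carrierI)
  fix D assume "D \<in> carrier (presented_group S R)"
  then obtain d where d: "d \<in> words S" "D = pres_cong S R `` {d}"
    by (rule presented_group_carrierE)
  show "A \<otimes>\<^bsub>presented_group S R\<^esub> B \<otimes>\<^bsub>presented_group S R\<^esub> D
      = A \<otimes>\<^bsub>presented_group S R\<^esub> (B \<otimes>\<^bsub>presented_group S R\<^esub> D)"
    using a b d by (simp add: presented_group_mult)
qed

lemma pres_cong_restrict_mono: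
  assumes "(v, w) \<in> pres_cong I (rels_restrict R I)" "I \<subseteq> S"
  shows "(v, w) \<in> pres_cong S R"
proof -
  have mono: "u \<in> words I \<Longrightarrow> u \<in> words S" for u
    using assms(2) unfolding words_def by auto
  show ?thesis
    using assms(1)
  proof induction
    case (cancel u v x b)
    then show ?case using mono assms(2) by (blast intro: pres_cong.cancel)
  next
    case (rel u v l r)
    then show ?case using mono by (auto simp: rels_restrict_def intro: pres_cong.rel)
  next
    case (refl w)
    then show ?case by (simp add: mono pres_cong.refl)
  next
    case (sym v w)
    then show ?case by (simp add: pres_cong.sym)
  next
    case (trans u v w)
    then show ?case by (meson pres_cong.trans)
  qed
qed

lemma pres_natural_class:
  assumes "w \<in> words I" "I \<subseteq> S"
  shows "pres_natural S R (pres_cong I (rels_restrict R I) `` {w}) = pres_cong S R `` {w}"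
proof -
  have "congruent (pres_cong I (rels_restrict R I)) (\<lambda>w. pres_cong S R `` {w})"
    by (rule congruentI) (rule pres_cong_class_eq, rule pres_cong_restrict_mono[OF _ assms(2)])
  from UN_equiv_class[OF equiv_pres_cong this assms(1)]
  show ?thesis by (simp add: pres_natural_def)
qed

end

theory Submission
  imports Defs
begin

text \<open>
  Let a word \<open>s\<^sub>1 s\<^sub>2 \<dots> s\<^sub>k\<close> in the generators of the cactus group act on the integers by the interval
  reversals, and label its \<open>j\<close>-th letter by the set of integers which that letter reverses, pulled
  back through the letters before it. The relations of the cactus group become, on labels, those of
  the right-angled Coxeter group on finite sets, where two sets commute iff they are disjoint or
  nested. In a right-angled Coxeter group two equal words have a common descendant under swaps of
  adjacent commuting letters and deletions of squares; no insertion is needed. Each swap or deletion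
  of labels lifts to a relation between words of intervals, and for words over a symmetric
  collection that relation only involves intervals of the collection. Since a word is determined by
  its labels, words over the collection which are equal in the cactus group are already equal in the
  group presented by the collection.
\<close>

section \<open>Words in right-angled Coxeter groups\<close>

locale right_angled =
  fixes comm :: "'a \<Rightarrow> 'a \<Rightarrow> bool"
  assumes comm_sym: "comm a b \<Longrightarrow> comm b a"
begin

text \<open>Equality in the partially commutative (trace) monoid defined by
  \<open>comm\<close>.\<close>

inductive trace_eq :: "'a list \<Rightarrow> 'a list \<Rightarrow> bool" where
  refl: "trace_eq w w"
| swap: "comm a b \<Longrightarrow> trace_eq (a # b # w) (b # a # w)"
| Cons: "trace_eq v w \<Longrightarrow> trace_eq (a # v) (a # w)"
| trans: "trace_eq u v \<Longrightarrow> trace_eq v w \<Longrightarrow> trace_eq u w"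

lemma trace_eq_sym: "trace_eq v w \<Longrightarrow> trace_eq w v"
proof (induction rule: trace_eq.induct)
  case (trans u v w)
  then show ?case by (blast intro: trace_eq.trans)
qed (simp_all add: trace_eq.refl trace_eq.Cons trace_eq.swap comm_sym)

text \<open>Insertions are left out on purpose: an inserted square of labels need not come from
  intervals of the collection.\<close>

inductive step :: "'a list \<Rightarrow> 'a list \<Rightarrow> bool" where
  swap: "comm a b \<Longrightarrow> step (a # b # w) (b # a # w)"
| delete: "step (a # a # w) w"
| Cons: "step v w \<Longrightarrow> step (a # v) (a # w)"

lemma steps_Cons: "step\<^sup>*\<^sup>* v w \<Longrightarrow> step\<^sup>*\<^sup>* (a # v) (a # w)"
  by (induction rule: rtranclp_induct) (simp, blast intro: rtranclp.rtrancl_into_rtrancl step.Cons)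

lemma step_append: "step v w \<Longrightarrow> step (u @ v) (u @ w)"
  by (induction u) (auto intro: step.Cons)

lemma trace_eq_steps: "trace_eq v w \<Longrightarrow> step\<^sup>*\<^sup>* v w"
proof (induction rule: trace_eq.induct)
  case (trans u v w)
  then show ?case by (simp add: rtranclp_trans)
qed (simp_all add: r_into_rtranclp step.swap steps_Cons)

section \<open>Moving a letter to the front\<close>

text \<open>\<open>pull a w\<close> removes from \<open>w\<close> an occurrence of \<open>a\<close> that can be moved to the front by swaps.\<close>

primrec pull :: "'a \<Rightarrow> 'a list \<Rightarrow> 'a list option" where
  "pull a [] = None"
| "pull a (b # w) = (if a = b then Some w else if comm a b then map_option ((#) b) (pull a w)
    else None)"

lemma pull_Some: "pull a w = Some w' \<Longrightarrow> trace_eq w (a # w')"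
proof (induction w arbitrary: w')
  case (Cons b w)
  show ?case
  proof (cases "a = b")
    case False
    with Cons.prems obtain v where v: "comm a b" "pull a w = Some v" "w' = b # v"
      by (auto split: if_splits)
    then have "trace_eq (b # w) (b # a # v)"
      by (simp add: Cons.IH trace_eq.Cons)
    then show ?thesis
      using v by (blast intro: trace_eq.trans trace_eq.swap comm_sym)
  qed (use Cons.prems in \<open>auto intro: trace_eq.refl\<close>)
qed simp

text \<open>This makes pulling, and hence \<open>act\<close>, well defined on trace classes. If the
  swapped pair contains \<open>a\<close> itself, both sides leave the same word.\<close>

lemma pull_trace_eq: "trace_eq v w \<Longrightarrow> rel_option trace_eq (pull a v) (pull a w)"
proof (induction rule: trace_eq.induct)
  case (refl w)
  show ?case by (simp add: option.rel_refl trace_eq.refl)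
next
  case (swap b c w)
  then show ?case
    by (cases "pull a w") (auto intro: trace_eq.intros dest: comm_sym)
next
  case (Cons v w b)
  then show ?case
    by (cases "pull a v"; cases "pull a w") (auto intro: trace_eq.Cons)
next
  case (trans u v w)
  then show ?case
    by (cases "pull a u"; cases "pull a v"; cases "pull a w") (auto intro: trace_eq.trans)
qed

text \<open>On trace classes of reduced words this is left multiplication by the generator
  \<open>a\<close> in the Coxeter group.\<close>

definition act :: "'a \<Rightarrow> 'a list \<Rightarrow> 'a list" where
  "act a w = (case pull a w of None \<Rightarrow> a # w | Some w' \<Rightarrow> w')"

lemma act_trace_eq: "trace_eq v w \<Longrightarrow> trace_eq (act a v) (act a w)"
  using pull_trace_eq[of v w a]
  by (auto simp: act_def intro: trace_eq.Cons split: option.splits)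

section \<open>Reduced words and the action of the generators on them\<close>

primrec reduced :: "'a list \<Rightarrow> bool" where
  "reduced [] = True"
| "reduced (a # w) = (pull a w = None \<and> reduced w)"

lemma reduced_trace_eq: "trace_eq v w \<Longrightarrow> reduced v = reduced w"
proof (induction rule: trace_eq.induct)
  case (swap a b w)
  then show ?case
    using comm_sym by auto
next
  case (Cons v w a)
  then show ?case
    using pull_trace_eq[of v w a] by (auto simp: option_rel_Some1)
qed simp_all

lemma reduced_pull: "reduced w \<Longrightarrow> pull a w = Some w' \<Longrightarrow> reduced (a # w')"
  using pull_Some reduced_trace_eq by blast

lemma reduced_act: "reduced w \<Longrightarrow> reduced (act a w)"
  using reduced_pull[of w a] by (auto simp: act_def split: option.split)

text \<open>If an \<open>a\<close> was pulled out, reducedness leaves no second one to pull, so the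
  second action puts \<open>a\<close> back in front. Otherwise the second action removes the
  \<open>a\<close> just prepended.\<close>

lemma act_act: "reduced w \<Longrightarrow> trace_eq (act a (act a w)) w"
  using reduced_pull[of w a] pull_Some[of a w]
  by (auto simp: act_def intro: trace_eq.refl trace_eq_sym split: option.split)

text \<open>Up to swaps \<open>w\<close> is \<open>b # v\<close>. There \<open>act a\<close> passes
  the leading \<open>b\<close>, which \<open>act b\<close> then removes, so both orders amount to
  \<open>act a v\<close>.\<close>

lemma act_commute_pulled:
  assumes "comm a b" "pull b w = Some v"
  shows "trace_eq (act a (act b w)) (act b (act a w))"
proof (cases "a = b")
  case False
  have w: "trace_eq w (b # v)"
    using assms(2) by (rule pull_Some)
  have "trace_eq (act b (act a w)) (act b (act a (b # v)))"
    by (intro act_trace_eq w)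
  moreover have "act b (act a (b # v)) = act a v"
    using False assms(1) comm_sym by (cases "pull a v") (auto simp: act_def)
  moreover have "act b w = v"
    using assms(2) by (simp add: act_def)
  ultimately show ?thesis
    using trace_eq_sym by metis
qed (simp add: trace_eq.refl)

text \<open>If neither letter can be pulled, both are prepended and the results differ by one swap.
  Otherwise \<open>act_commute_pulled\<close> applies, possibly with \<open>a\<close> and
  \<open>b\<close> exchanged.\<close>

lemma act_commute:
  assumes "comm a b"
  shows "trace_eq (act a (act b w)) (act b (act a w))"
proof (cases "pull a w = None \<and> pull b w = None \<and> a \<noteq> b")
  case True
  then show ?thesis
    using assms comm_sym by (auto simp: act_def intro: trace_eq.swap)
next
  case False
  then show ?thesis
    using act_commute_pulled assms comm_sym trace_eq_sym trace_eq.refl by (metis option.exhaust)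
qed

section \<open>Normal forms and confluence\<close>

definition nf :: "'a list \<Rightarrow> 'a list" where
  "nf w = foldr act w []"

lemma reduced_nf: "reduced (nf w)"
  by (induction w) (auto simp: nf_def reduced_act)

lemma steps_act: "step\<^sup>*\<^sup>* (a # w) (act a w)"
proof (cases "pull a w")
  case (Some v)
  then have "step\<^sup>*\<^sup>* (a # w) (a # a # v)"
    by (intro steps_Cons trace_eq_steps pull_Some)
  then show ?thesis
    using Some step.delete by (auto simp: act_def intro: rtranclp.rtrancl_into_rtrancl)
qed (simp add: act_def)

lemma steps_nf: "step\<^sup>*\<^sup>* w (nf w)"
proof (induction w)
  case (Cons a w)
  then have "step\<^sup>*\<^sup>* (a # w) (a # nf w)"
    by (rule steps_Cons)
  also have "step\<^sup>*\<^sup>* (a # nf w) (nf (a # w))"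
    using steps_act by (simp add: nf_def)
  finally show ?case .
qed (simp add: nf_def)

text \<open>The two defining relations hold for the action by \<open>act_commute\<close> and
  \<open>act_act\<close>; the latter applies because normal forms are reduced.\<close>

lemma nf_step: "step v w \<Longrightarrow> trace_eq (nf v) (nf w)"
proof (induction rule: step.induct)
  case (delete a w)
  then show ?case
    using act_act[OF reduced_nf] by (simp add: nf_def)
qed (simp_all add: nf_def act_commute act_trace_eq)

lemma nf_equivclp: "equivclp step v w \<Longrightarrow> trace_eq (nf v) (nf w)"
proof (induction rule: equivclp_induct)
  case base
  show ?case by (rule trace_eq.refl)
next
  case (step y z)
  then have "trace_eq (nf y) (nf z)"
    using nf_step trace_eq_sym by blast
  with step.IH show ?case by (rule trace_eq.trans)
qed

text \<open>The common descendant is \<open>nf w\<close>: the word \<open>v\<close> descends to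
  \<open>nf v\<close>, and swaps alone lead on from there.\<close>

theorem church_rosser:
  assumes "equivclp step v w"
  obtains z where "step\<^sup>*\<^sup>* v z" "step\<^sup>*\<^sup>* w z"
proof
  show "step\<^sup>*\<^sup>* v (nf w)"
    using steps_nf[of v] trace_eq_steps[OF nf_equivclp[OF assms]] by simp
qed (rule steps_nf)

end

section \<open>Interval reversals\<close>

fun ivl :: "nat \<times> nat \<Rightarrow> nat set" where
  "ivl (p, q) = {p..q}"

fun flip :: "nat \<times> nat \<Rightarrow> nat \<Rightarrow> nat" where
  "flip (p, q) i = (if p \<le> i \<and> i \<le> q then p + q - i else i)"

text \<open>The image of the inner interval \<open>(m, r)\<close> under the reversal of
  \<open>(p, q)\<close>, as in (j3). The subtractions are exact when \<open>m < r\<close> and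
  \<open>r \<le> q\<close>.\<close>

fun mirror :: "nat \<times> nat \<Rightarrow> nat \<times> nat \<Rightarrow> nat \<times> nat" where
  "mirror (p, q) (m, r) = (p + q - r, p + q - m)"

abbreviation proper :: "nat \<times> nat \<Rightarrow> bool" where
  "proper x \<equiv> fst x < snd x"

lemma flip_flip [simp]: "flip x (flip x i) = i"
  by (cases x) auto

lemma inj_flip: "inj (flip x)"
  by (rule inj_on_inverseI[of _ "flip x"]) simp

lemma flip_image_ivl_superset: "ivl x \<subseteq> ivl y \<Longrightarrow> flip x ` ivl y = ivl y"
proof -
  assume "ivl x \<subseteq> ivl y"
  then have "flip x ` ivl y \<subseteq> ivl y"
    by (cases x; cases y) fastforce
  \<comment> \<open>Applying the involution \<open>flip x\<close> to the inclusion turns it into the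
    reverse one.\<close>
  moreover from this have "flip x ` flip x ` ivl y \<subseteq> flip x ` ivl y"
    by blast
  ultimately show ?thesis
    by (simp add: image_image)
qed

lemma flip_image_ivl_self [simp]: "flip x ` ivl x = ivl x"
  by (simp add: flip_image_ivl_superset)

lemma flip_image_ivl_disjoint: "ivl x \<inter> ivl y = {} \<Longrightarrow> flip x ` ivl y = ivl y"
proof -
  assume "ivl x \<inter> ivl y = {}"
  then have "flip x i = i" if "i \<in> ivl y" for i
    using that by (cases x; cases y) fastforce
  then show ?thesis by simp
qed

lemma flip_image_ivl_subset:
  assumes "ivl y \<subseteq> ivl x" "proper y"
  shows "flip x ` ivl y = ivl (mirror x y)"
proof -
  obtain p q m r where xy: "x = (p, q)" "y = (m, r)"
    by (cases x; cases y)
  then have "p \<le> m" "r \<le> q" "m < r"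
    using assms by auto
  then have "i \<in> flip x ` ivl y" if "i \<in> ivl (mirror x y)" for i
    using that xy by (intro image_eqI[of _ _ "p + q - i"]) auto
  moreover have "flip x ` ivl y \<subseteq> ivl (mirror x y)"
    using \<open>p \<le> m\<close> \<open>r \<le> q\<close> \<open>m < r\<close> xy by auto
  ultimately show ?thesis by blast
qed

lemma ivl_eq_iff: "proper x \<Longrightarrow> proper y \<Longrightarrow> ivl x = ivl y \<longleftrightarrow> x = y"
  by (cases x; cases y) auto

lemma flip_commute_disjoint:
  assumes "ivl x \<inter> ivl y = {}" "proper x" "proper y"
  shows "flip x (flip y i) = flip y (flip x i)"
proof -
  obtain p q m r where xy: "x = (p, q)" "y = (m, r)"
    by (cases x; cases y)
  then have "q < m \<or> r < p"
    using assms by (force simp: disjoint_iff)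
  then show ?thesis
    using xy assms(2,3) by auto
qed

text \<open>Conjugating the reversal of \<open>y\<close> by that of \<open>x\<close> gives the
  reversal of the image of \<open>y\<close>: relation (j3) for permutations.\<close>

lemma flip_commute_subset:
  assumes "ivl y \<subseteq> ivl x" "proper y"
  shows "flip x (flip y i) = flip (mirror x y) (flip x i)"
proof -
  obtain p q m r where xy: "x = (p, q)" "y = (m, r)"
    by (cases x; cases y)
  then have "p \<le> m" "r \<le> q" "m < r"
    using assms by auto
  then show ?thesis
    using xy by auto
qed

section \<open>Labels\<close>

definition compatible :: "nat set \<Rightarrow> nat set \<Rightarrow> bool" where
  "compatible A B \<longleftrightarrow> A \<inter> B = {} \<or> A \<subseteq> B \<or> B \<subseteq> A"

interpretation label: right_angled compatible
  by unfold_locales (auto simp: compatible_def)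

text \<open>The map \<open>g\<close> accumulates the reversals of the letters already read; the
  newest one is composed on the right, so it is the first to act on the next interval.\<close>

fun labels :: "(nat \<Rightarrow> nat) \<Rightarrow> (nat \<times> nat) list \<Rightarrow> nat set list" where
  "labels g [] = []"
| "labels g (x # w) = g ` ivl x # labels (g \<circ> flip x) w"

lemma labels_append: "labels g (u @ v) = labels g u @ labels (foldl (\<lambda>h x. h \<circ> flip x) g u) v"
  by (induction u arbitrary: g) auto

lemma inj_comp_flip: "inj g \<Longrightarrow> inj (g \<circ> flip x)"
  using inj_compose inj_flip by blast

lemma inj_foldl_flip: "inj g \<Longrightarrow> inj (foldl (\<lambda>h x. h \<circ> flip x) g u)"
  by (induction u arbitrary: g) (simp_all add: inj_comp_flip del: comp_apply)

text \<open>Letters are recovered from left to right: injectivity of \<open>g\<close> yields the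
  first interval, which in turn determines the map used for the remaining labels.\<close>

lemma labels_inject:
  assumes "labels g u = labels g v" "inj g" "\<forall>x\<in>set u \<union> set v. proper x"
  shows "u = v"
  using assms
proof (induction u arbitrary: g v)
  case Nil
  then show ?case by (cases v) auto
next
  case (Cons x u)
  then obtain y v' where v: "v = y # v'"
    by (cases v) auto
  with Cons.prems have "x = y"
    by (simp add: inj_image_eq_iff ivl_eq_iff)
  moreover have "u = v'"
  proof (rule Cons.IH)
    show "labels (g \<circ> flip x) u = labels (g \<circ> flip x) v'"
      using Cons.prems(1) v \<open>x = y\<close> by simp
    show "inj (g \<circ> flip x)"
      using Cons.prems(2) by (rule inj_comp_flip)
  qed (use Cons.prems(3) v in simp)
  ultimately show ?case
    using v by simp
qed

lemma compatible_image_iff: "inj g \<Longrightarrow> compatible (g ` A) (g ` B) \<longleftrightarrow> compatible A B"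
  unfolding compatible_def by (simp add: inj_image_subset_iff image_Int[symmetric])

section \<open>Labels of the two sides of the cactus relations\<close>

lemma cactus_gens_proper: "x \<in> cactus_gens n \<Longrightarrow> proper x"
  by (auto simp: cactus_gens_def)

text \<open>The tail is written with the flips in the order of the swapped word
  \<open>y # x # w\<close>, so that the swap is visible on labels.\<close>

lemma labels_disjoint:
  assumes "ivl x \<inter> ivl y = {}" "proper x" "proper y"
  shows "labels g (x # y # w) = g ` ivl x # g ` ivl y # labels (g \<circ> flip y \<circ> flip x) w"
proof -
  have "flip x \<circ> flip y = flip y \<circ> flip x"
    using flip_commute_disjoint[OF assms] by auto
  then have "g \<circ> flip x \<circ> flip y = g \<circ> flip y \<circ> flip x"
    by (simp add: comp_assoc)
  moreover have "(g \<circ> flip x) ` ivl y = g ` ivl y"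
    using flip_image_ivl_disjoint[OF assms(1)] by (metis image_comp)
  ultimately show ?thesis by simp
qed

text \<open>The two sides of (j3) have the same first two labels in opposite orders and then the
  same tail: mirroring the inner interval matches its pull-back through the outer one.\<close>

lemma labels_subset:
  assumes "ivl y \<subseteq> ivl x" "proper y"
  shows "labels g (x # y # w)
      = g ` ivl x # g ` ivl (mirror x y) # labels (g \<circ> flip x \<circ> flip y) w"
    and "labels g (mirror x y # x # w)
      = g ` ivl (mirror x y) # g ` ivl x # labels (g \<circ> flip x \<circ> flip y) w"
proof -
  have "flip x \<circ> flip y = flip (mirror x y) \<circ> flip x"
    using flip_commute_subset[OF assms] by auto
  then have "g \<circ> flip (mirror x y) \<circ> flip x = g \<circ> flip x \<circ> flip y"
    by (simp add: comp_assoc)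
  moreover have "ivl (mirror x y) \<subseteq> ivl x"
    using flip_image_ivl_subset[OF assms] image_mono[OF assms(1), of "flip x"] by simp
  then have "(g \<circ> flip (mirror x y)) ` ivl x = g ` ivl x"
    using flip_image_ivl_superset by (metis image_comp)
  ultimately show "labels g (mirror x y # x # w)
      = g ` ivl (mirror x y) # g ` ivl x # labels (g \<circ> flip x \<circ> flip y) w"
    by simp
  show "labels g (x # y # w)
      = g ` ivl x # g ` ivl (mirror x y) # labels (g \<circ> flip x \<circ> flip y) w"
    using flip_image_ivl_subset[OF assms] unfolding labels.simps by (metis image_comp)
qed

lemma labels_square: "labels g (x # x # w) = g ` ivl x # g ` ivl x # labels g w"
proof -
  have "g \<circ> flip x \<circ> flip x = g"
    by auto
  moreover have "(g \<circ> flip x) ` ivl x = g ` ivl x"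
    by (metis flip_image_ivl_self image_comp)
  ultimately show ?thesis
    by simp
qed

lemma cactus_rels_cases:
  assumes "(l, r) \<in> cactus_rels n"
  obtains (square) x where "x \<in> cactus_gens n" "l = [(x, True), (x, True)]" "r = []"
  | (disjoint) x y where "x \<in> cactus_gens n" "y \<in> cactus_gens n" "ivl x \<inter> ivl y = {}"
      "l = [(x, True), (y, True)]" "r = [(y, True), (x, True)]"
  | (subset) x y where "x \<in> cactus_gens n" "y \<in> cactus_gens n" "ivl y \<subseteq> ivl x"
      "l = [(x, True), (y, True)]" "r = [(mirror x y, True), (x, True)]"
proof -
  from assms consider
      p q where "(p, q) \<in> cactus_gens n" "l = [((p, q), True), ((p, q), True)]" "r = []"
    | p q m k where "(p, q) \<in> cactus_gens n" "(m, k) \<in> cactus_gens n" "{p..q} \<inter> {m..k} = {}"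
      "l = [((p, q), True), ((m, k), True)]" "r = [((m, k), True), ((p, q), True)]"
    | p q m k where "(p, q) \<in> cactus_gens n" "(m, k) \<in> cactus_gens n" "{m..k} \<subseteq> {p..q}"
      "l = [((p, q), True), ((m, k), True)]" "r = [((p + q - k, p + q - m), True), ((p, q), True)]"
    unfolding cactus_rels_def by blast
  then show ?thesis
  proof cases
    case (1 p q)
    then show ?thesis by (rule square)
  next
    case (2 p q m k)
    then show ?thesis using disjoint[of "(p, q)" "(m, k)"] by simp
  next
    case (3 p q m k)
    then show ?thesis using subset[of "(p, q)" "(m, k)"] by (simp only: ivl.simps mirror.simps)
  qed
qed

text \<open>Squares give deletions. Relations (j2) and (j3) give swaps, which are allowed because an
  injective \<open>g\<close> keeps sets disjoint or nested.\<close>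

lemma labels_step_rel:
  assumes "(l, r) \<in> cactus_rels n" "inj g"
  shows "label.step (labels g (map fst (l @ w))) (labels g (map fst (r @ w)))"
  using assms(1)
proof (cases rule: cactus_rels_cases)
  case (square x)
  then show ?thesis
    by (simp only: append.simps list.map fst_conv labels_square label.step.delete)
next
  case (disjoint x y)
  then have "proper x" "proper y" "ivl y \<inter> ivl x = {}"
    by (auto simp: cactus_gens_proper)
  moreover have "compatible (g ` ivl x) (g ` ivl y)"
    unfolding compatible_image_iff[OF assms(2)] using disjoint by (simp add: compatible_def)
  \<comment> \<open>\<open>labels_disjoint\<close> rewrites both sides of the relation, leaving
    tails with the two flips in opposite orders.\<close>
  moreover have "g \<circ> flip y \<circ> flip x = g \<circ> flip x \<circ> flip y"
    using flip_commute_disjoint[of x y] calculation disjoint by auto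
  ultimately show ?thesis
    using disjoint
    by (simp only: append.simps list.map fst_conv labels_disjoint label.step.swap)
next
  case (subset x y)
  then have y: "proper y"
    by (simp add: cactus_gens_proper)
  have "ivl (mirror x y) \<subseteq> ivl x"
    using flip_image_ivl_subset[OF subset(3) y] image_mono[OF subset(3), of "flip x"] by simp
  then have "compatible (g ` ivl x) (g ` ivl (mirror x y))"
    unfolding compatible_image_iff[OF assms(2)] by (simp add: compatible_def)
  then show ?thesis
    using subset y
    by (simp only: append.simps list.map fst_conv labels_subset label.step.swap)
qed

text \<open>Signs can be forgotten by \<open>map fst\<close> since generators are involutions: a
  cancelled pair becomes a deleted square. The letters before the change only replace
  \<open>g\<close> by another map \<open>?h\<close>, injective again if \<open>g\<close> is.\<close>

lemma labels_pres_cong: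
  assumes "(u, v) \<in> pres_cong (cactus_gens n) (cactus_rels n)" "inj g"
  shows "equivclp label.step (labels g (map fst u)) (labels g (map fst v))"
  using assms
proof induction
  case (cancel u v x b)
  let ?h = "foldl (\<lambda>h x. h \<circ> flip x) g (map fst u)"
  have "label.step (labels ?h (x # x # map fst v)) (labels ?h (map fst v))"
    unfolding labels_square by (rule label.step.delete)
  then show ?case
    by (simp add: labels_append label.step_append r_into_equivclp)
next
  case (rel u v l r)
  let ?h = "foldl (\<lambda>h x. h \<circ> flip x) g (map fst u)"
  have "label.step (labels ?h (map fst (l @ v))) (labels ?h (map fst (r @ v)))"
    using rel by (intro labels_step_rel inj_foldl_flip)
  then have "label.step (labels g (map fst u @ map fst (l @ v)))
      (labels g (map fst u @ map fst (r @ v)))"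
    unfolding labels_append[of g "map fst u"] by (rule label.step_append)
  then show ?case
    by (simp add: r_into_equivclp)
next
  case (refl w)
  show ?case by simp
next
  case (sym v w)
  then show ?case by (simp add: equivclp_sym)
next
  case (trans u v w)
  then show ?case using equivclp_trans by metis
qed

section \<open>Lifting to a symmetric collection\<close>

abbreviation pos_word :: "'a list \<Rightarrow> 'a word" where
  "pos_word \<equiv> map (\<lambda>x. (x, True))"

lemma pos_word_in_words: "pos_word w \<in> words S \<longleftrightarrow> set w \<subseteq> S"
  by (induction w) auto

locale symmetric_intervals =
  fixes n :: nat and C :: "(nat \<times> nat) set"
  assumes C_gens: "C \<subseteq> cactus_gens n"
    and C_symmetric: "symmetric_collection C"
begin

abbreviation cong :: "((nat \<times> nat) word \<times> (nat \<times> nat) word) set" where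
  "cong \<equiv> pres_cong C (rels_restrict (cactus_rels n) C)"

lemma C_proper: "x \<in> C \<Longrightarrow> proper x"
  using C_gens cactus_gens_proper by blast

text \<open>This is where symmetry of the collection enters: it keeps applications of (j3) inside
  \<open>C\<close>.\<close>

lemma mirror_in_C: "x \<in> C \<Longrightarrow> y \<in> C \<Longrightarrow> ivl y \<subseteq> ivl x \<Longrightarrow> mirror x y \<in> C"
  using C_symmetric unfolding symmetric_collection_def by (cases x; cases y) auto

section \<open>The congruence over the collection\<close>

lemma cong_rel:
  assumes "(l, r) \<in> cactus_rels n" "l \<in> words C" "r \<in> words C" "w \<in> words C"
  shows "(l @ w, r @ w) \<in> cong"
  using pres_cong.rel[of "[]" C w l r] assms by (simp add: rels_restrict_def)

lemma cong_square:
  assumes "x \<in> C" "w \<in> words C"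
  shows "((x, True) # (x, True) # w, w) \<in> cong"
proof -
  have "([(x, True), (x, True)], []) \<in> cactus_rels n"
    using assms C_gens by (cases x) (auto simp: cactus_rels_def)
  from cong_rel[OF this] show ?thesis
    using assms by simp
qed

lemma cong_disjoint:
  assumes "x \<in> C" "y \<in> C" "ivl x \<inter> ivl y = {}" "w \<in> words C"
  shows "((x, True) # (y, True) # w, (y, True) # (x, True) # w) \<in> cong"
proof -
  have "([(x, True), (y, True)], [(y, True), (x, True)]) \<in> cactus_rels n"
    using assms C_gens by (cases x; cases y) (auto simp: cactus_rels_def)
  from cong_rel[OF this] show ?thesis
    using assms by simp
qed

lemma cong_subset:
  assumes "x \<in> C" "y \<in> C" "ivl y \<subseteq> ivl x" "w \<in> words C"
  shows "((x, True) # (y, True) # w, (mirror x y, True) # (x, True) # w) \<in> cong"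
proof -
  have "([(x, True), (y, True)], [(mirror x y, True), (x, True)]) \<in> cactus_rels n"
    using assms C_gens by (cases x; cases y) (auto simp: cactus_rels_def)
  from cong_rel[OF this] show ?thesis
    using assms mirror_in_C by simp
qed

lemma cong_Cons: "(u, v) \<in> cong \<Longrightarrow> x \<in> C \<Longrightarrow> ((x, b) # u, (x, b) # v) \<in> cong"
  using pres_cong_context[of u v C _ "[(x, b)]" "[]"] by simp

lemma cong_pos_word: "w \<in> words C \<Longrightarrow> (w, pos_word (map fst w)) \<in> cong"
proof (induction w)
  case Nil
  then show ?case by (simp add: pres_cong.refl)
next
  case (Cons a w)
  obtain x b where a: "a = (x, b)"
    by (cases a)
  with Cons.prems have x: "x \<in> C" "w \<in> words C"
    by simp_all
  have "((x, b) # w, (x, True) # w) \<in> cong"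
  proof (cases b)
    case False
    \<comment> \<open>Insert the square of \<open>x\<close> behind its formal inverse; cancellation
      then leaves a single positive letter.\<close>
    have "((x, False) # w, (x, False) # (x, True) # (x, True) # w) \<in> cong"
      using x by (intro pres_cong.sym[OF cong_Cons] cong_square)
    moreover have "((x, False) # (x, True) # (x, True) # w, (x, True) # w) \<in> cong"
      using pres_cong.cancel[of "[]" C "(x, True) # w" x False] x by simp
    ultimately have "((x, False) # w, (x, True) # w) \<in> cong"
      by (rule pres_cong.trans)
    then show ?thesis
      using False by simp
  qed (use x in \<open>simp add: pres_cong.refl\<close>)
  moreover have "((x, True) # w, (x, True) # pos_word (map fst w)) \<in> cong"
    using x by (intro cong_Cons Cons.IH)
  ultimately have "((x, b) # w, (x, True) # pos_word (map fst w)) \<in> cong"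
    by (rule pres_cong.trans)
  then show ?case
    using a by simp
qed

text \<open>Injectivity transfers the relation between two labels back to the intervals. A swap then
  lifts to (j2) or to (j3) in one of its two directions, and a deletion to (j1).\<close>

lemma lift_step:
  assumes "label.step (labels g w) z" "set w \<subseteq> C" "inj g"
  shows "\<exists>w'. set w' \<subseteq> C \<and> labels g w' = z \<and> (pos_word w, pos_word w') \<in> cong"
  using assms
proof (induction "labels g w" z arbitrary: g w rule: label.step.induct)
  case (swap A B v)
  then obtain x y u where w: "w = x # y # u"
    by (metis labels.simps list.exhaust list.distinct(1) list.inject)
  have xy: "x \<in> C" "y \<in> C" "set u \<subseteq> C" "pos_word u \<in> words C" "proper x" "proper y"
    using w swap.prems by (auto simp: pos_word_in_words C_proper)
  have AB: "A = g ` ivl x" "B = g ` flip x ` ivl y" "v = labels (g \<circ> flip x \<circ> flip y) u"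
    using swap.hyps(2) w by (simp_all add: image_comp)
  \<comment> \<open>Since \<open>flip x\<close> preserves \<open>ivl x\<close>, both labels are
    images under \<open>g\<close> after \<open>flip x\<close>, and both injections can be
    stripped.\<close>
  have "compatible (flip x ` ivl x) (flip x ` ivl y)"
    using swap.hyps(1) swap.prems(2) AB by (simp add: compatible_image_iff)
  then have "compatible (ivl x) (ivl y)"
    unfolding compatible_image_iff[OF inj_flip] .
  then consider "ivl x \<inter> ivl y = {}" | "ivl y \<subseteq> ivl x" | "ivl x \<subseteq> ivl y"
    by (auto simp: compatible_def)
  then show ?case
  proof cases
    case 1
    then have "labels g (y # x # u) = B # A # v"
      using AB xy labels_disjoint[of y x g u] flip_image_ivl_disjoint[OF 1]
      by (simp only: Int_commute)
    then show ?thesis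
      using cong_disjoint[OF xy(1,2) 1 xy(4)] w xy by (intro exI[of _ "y # x # u"]) simp
  next
    case 2
    then have "labels g (mirror x y # x # u) = B # A # v"
      using AB xy labels_subset(2)[OF 2] flip_image_ivl_subset[OF 2] by (simp only:)
    then show ?thesis
      using cong_subset[OF xy(1,2) 2 xy(4)] w xy 2
      by (intro exI[of _ "mirror x y # x # u"]) (simp add: mirror_in_C)
  next
    case 3
    \<comment> \<open>Here (j3) is read from right to left: mirroring \<open>?x\<close> in
      \<open>y\<close> gives back \<open>x\<close>, so the product of \<open>x\<close> and
      \<open>y\<close> becomes that of \<open>y\<close> and \<open>?x\<close>.\<close>
    let ?x = "mirror y x"
    have x': "?x \<in> C" "ivl ?x \<subseteq> ivl y" "mirror y ?x = x"
    proof -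
      show "?x \<in> C"
        using 3 xy by (simp add: mirror_in_C)
      show "ivl ?x \<subseteq> ivl y" "mirror y ?x = x"
        using 3 xy(5) by (cases x; cases y; auto)+
    qed
    have "labels g (y # ?x # u) = B # A # v"
    proof -
      have "flip y \<circ> flip ?x = flip x \<circ> flip y"
        using flip_commute_subset[of ?x y] x' C_proper[of ?x] by auto
      then have "g \<circ> flip y \<circ> flip ?x = g \<circ> flip x \<circ> flip y"
        by (simp add: comp_assoc)
      then show ?thesis
        using AB labels_subset(1)[OF x'(2) C_proper[OF x'(1)]] x'(3)
          flip_image_ivl_superset[OF 3] by (simp only:)
    qed
    moreover have "((x, True) # (y, True) # pos_word u, (y, True) # (?x, True) # pos_word u) \<in> cong"
      using cong_subset[OF xy(2) x'(1,2) xy(4), THEN pres_cong.sym] unfolding x'(3) .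
    ultimately show ?thesis
      using w xy x'(1) by (intro exI[of _ "y # ?x # u"]) simp
  qed
next
  case (delete A v)
  then obtain x y u where w: "w = x # y # u"
    by (metis labels.simps list.exhaust list.distinct(1) list.inject)
  have "g ` flip x ` ivl x = g ` flip x ` ivl y"
    using delete.hyps w unfolding labels.simps flip_image_ivl_self image_comp by auto
  then have "ivl x = ivl y"
    using delete.prems(2) by (simp only: inj_image_eq_iff inj_flip)
  then have "x = y"
    using delete.prems(1) w by (simp add: C_proper ivl_eq_iff)
  then have "labels g u = v"
    using delete.hyps w labels_square[of g x u] by (metis list.inject)
  then show ?case
    using cong_square[of x "pos_word u"] delete.prems(1) w \<open>x = y\<close>
    by (intro exI[of _ u]) (simp add: pos_word_in_words)
next
  case (Cons v z A)
  then obtain x u where w: "w = x # u"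
    by (metis labels.simps(1) list.exhaust list.distinct(1))
  have "v = labels (g \<circ> flip x) u" "inj (g \<circ> flip x)" "set u \<subseteq> C" "x \<in> C" "A = g ` ivl x"
    using Cons.hyps(3) Cons.prems(1) w inj_comp_flip[OF Cons.prems(2)] by auto
  with Cons.hyps(2) obtain u' where "set u' \<subseteq> C" "labels (g \<circ> flip x) u' = z"
    "(pos_word u, pos_word u') \<in> cong"
    by blast
  then show ?case
    using w \<open>x \<in> C\<close> \<open>A = _\<close> by (intro exI[of _ "x # u'"]) (simp add: cong_Cons)
qed

lemma lift_steps:
  assumes "label.step\<^sup>*\<^sup>* (labels g w) z" "set w \<subseteq> C" "inj g"
  shows "\<exists>w'. set w' \<subseteq> C \<and> labels g w' = z \<and> (pos_word w, pos_word w') \<in> cong"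
  using assms(1)
proof (induction rule: rtranclp_induct)
  case base
  then show ?case
    using assms(2) by (intro exI[of _ w]) (simp add: pos_word_in_words pres_cong.refl)
next
  case (step y z)
  then show ?case
    using lift_step assms(3) by (meson pres_cong.trans)
qed

text \<open>Both words are rewritten over \<open>C\<close> until their labels agree in the common
  descendant \<open>z\<close>; the resulting words then coincide because labels determine
  them.\<close>

theorem cong_if_cactus_cong:
  assumes "(u, v) \<in> pres_cong (cactus_gens n) (cactus_rels n)" "u \<in> words C" "v \<in> words C"
  shows "(u, v) \<in> cong"
proof -
  have sets: "set (map fst u) \<subseteq> C" "set (map fst v) \<subseteq> C"
    using assms(2,3) by (auto simp: words_def)
  have "equivclp label.step (labels id (map fst u)) (labels id (map fst v))"
    using assms(1) by (rule labels_pres_cong) simp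
  then obtain z where "label.step\<^sup>*\<^sup>* (labels id (map fst u)) z"
    "label.step\<^sup>*\<^sup>* (labels id (map fst v)) z"
    by (rule label.church_rosser)
  then obtain u' v' where
    "set u' \<subseteq> C" "labels id u' = z" and u: "(pos_word (map fst u), pos_word u') \<in> cong"
    and "set v' \<subseteq> C" "labels id v' = z" and v: "(pos_word (map fst v), pos_word v') \<in> cong"
    using lift_steps sets inj_on_id by metis
  then have "u' = v'"
    by (intro labels_inject[of id]) (auto dest: C_proper)
  then have "(pos_word (map fst u), pos_word (map fst v)) \<in> cong"
    using u v by (metis pres_cong.sym pres_cong.trans)
  then show ?thesis
    using cong_pos_word assms(2,3) by (meson pres_cong.sym pres_cong.trans)
qed

end

theorem theorem3p7:
  fixes n :: nat and C :: "(nat \<times> nat) set"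
  assumes "n \<ge> 2"
    and "C \<subseteq> cactus_gens n"
    and "symmetric_collection C"
  shows "pres_natural (cactus_gens n) (cactus_rels n)
      \<in> hom (cactus_restricted_group n C) (cactus_group n)
    \<and> (\<forall>I\<in>C. pres_natural (cactus_gens n) (cactus_rels n)
          (pres_gen C (rels_restrict (cactus_rels n) C) I)
        = pres_gen (cactus_gens n) (cactus_rels n) I)
    \<and> inj_on (pres_natural (cactus_gens n) (cactus_rels n)) (carrier (cactus_restricted_group n C))
    \<and> complete_gens (cactus_gens n) (cactus_rels n) C"
proof -
  interpret symmetric_intervals n C
    using assms by unfold_locales
  let ?S = "cactus_gens n" and ?R = "cactus_rels n"
  have mono: "w \<in> words C \<Longrightarrow> w \<in> words ?S" for w
    using C_gens by (auto simp: words_def)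
  note natural = pres_natural_class[OF _ C_gens]
  have "pres_natural ?S ?R \<in> hom (cactus_restricted_group n C) (cactus_group n)"
    unfolding cactus_restricted_group_def cactus_group_def
    by (rule homI; elim presented_group_carrierE)
      (simp_all add: natural mono presented_group_carrierI presented_group_mult)
  moreover have "\<forall>I\<in>C. pres_natural ?S ?R (pres_gen C (rels_restrict ?R C) I) = pres_gen ?S ?R I"
    by (simp add: pres_gen_def natural)
  \<comment> \<open>The natural map keeps representatives, so injectivity says that words over
    \<open>C\<close> congruent in the cactus group are already congruent over
    \<open>C\<close>.\<close>
  moreover have "inj_on (pres_natural ?S ?R) (carrier (presented_group C (rels_restrict ?R C)))"
  proof (rule inj_onI; elim presented_group_carrierE)
    fix A B u v
    assume eq: "pres_natural ?S ?R A = pres_natural ?S ?R B"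
      and u: "u \<in> words C" "A = cong `` {u}" and v: "v \<in> words C" "B = cong `` {v}"
    then have "pres_cong ?S ?R `` {u} = pres_cong ?S ?R `` {v}"
      by (simp add: natural)
    then have "(u, v) \<in> pres_cong ?S ?R"
      using eq_equiv_class[OF _ equiv_pres_cong mono[OF v(1)]] by blast
    then show "A = B"
      using u v by (simp add: cong_if_cactus_cong pres_cong_class_eq)
  qed
  ultimately show ?thesis
    using C_gens by (simp add: complete_gens_def cactus_restricted_group_def)
qed

end
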